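(* Every isosceles Heron triangle having two sides whose lengths are perfect squares is obtained, by scaling by a suitable positive rational factor, from the triangle with side lengths $\left(1,\,1,\,\dfrac{4k}{k^2+1}\right)$ for some positive rational number $k\neq 1$.
   Context: A Heron triangle is a (non-degenerate) triangle whose three side lengths and whose area are all positive integers. *)

theory Defs
  imports "HOL-Analysis.Analysis" "HOL-Library.Multiset"
begin

text \<open>Triangles are given by their three vertices in the Euclidean plane.\<close>

definition is_triangle :: "real^2 \<Rightarrow> real^2 \<Rightarrow> real^2 \<Rightarrow> bool" where
  "is_triangle A B C \<longleftrightarrow> \<not> collinear {A, B, C}"

text \<open>Side lengths are unordered but counted with multiplicity.\<close>

definition side_lengths :: "real^2 \<Rightarrow> real^2 \<Rightarrow> real^2 \<Rightarrow> real multiset" where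
  "side_lengths A B C = {# dist B C, dist C A, dist A B #}"

definition triangle_area :: "real^2 \<Rightarrow> real^2 \<Rightarrow> real^2 \<Rightarrow> real" where
  "triangle_area A B C = measure lebesgue (convex hull {A, B, C})"

definition pos_integer :: "real \<Rightarrow> bool" where
  "pos_integer x \<longleftrightarrow> x \<in> \<int> \<and> x > 0"

definition heron_triangle :: "real^2 \<Rightarrow> real^2 \<Rightarrow> real^2 \<Rightarrow> bool" where
  "heron_triangle A B C \<longleftrightarrow>
     is_triangle A B C \<and>
     (\<forall>s \<in># side_lengths A B C. pos_integer s) \<and>
     pos_integer (triangle_area A B C)"

definition isosceles :: "real^2 \<Rightarrow> real^2 \<Rightarrow> real^2 \<Rightarrow> bool" where
  "isosceles A B C \<longleftrightarrow> (\<exists>s. {# s, s #} \<subseteq># side_lengths A B C)"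

text \<open>Multiset inclusion makes the two sides distinct sides of the triangle, possibly
  of the same length.\<close>

definition has_two_square_sides :: "real^2 \<Rightarrow> real^2 \<Rightarrow> real^2 \<Rightarrow> bool" where
  "has_two_square_sides A B C \<longleftrightarrow>
     (\<exists>m n :: nat. {# real (m ^ 2), real (n ^ 2) #} \<subseteq># side_lengths A B C)"

end

theory Submission
  imports Defs
begin

text \<open>
  Let the sides be \<open>a, a, b\<close> and the area \<open>S\<close>. Half of the apex angle has sine \<open>b / (2 * a)\<close> and
  cosine \<open>2 * S / (a * b)\<close>, both rational. The tangent \<open>k\<close> of a quarter of the apex angle is
  therefore rational, and the double-angle formula gives \<open>b / a = 4 * k / (k\<^sup>2 + 1)\<close>.
  Scale by \<open>q = a\<close>.
\<close>

text \<open>Heron's formula with semiperimeter \<open>s = a + b / 2\<close>: here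
  \<open>s * (s - b) = a\<^sup>2 - b\<^sup>2 / 4\<close> and
  \<open>(s - a)\<^sup>2 = b\<^sup>2 / 4\<close>.\<close>

lemma triangle_area_isosceles:
  assumes "side_lengths A B C = {#a, a, b#}"
  shows "triangle_area A B C = sqrt (b\<^sup>2 * (4 * a\<^sup>2 - b\<^sup>2)) / 4"
proof -
  define s where "s = (a + a + b) / 2"
  have "compact (convex hull {A, B, C})"
    by (intro compact_convex_hull finite_imp_compact) auto
  \<comment> \<open>\<open>heron\<close> measures area with \<open>lborel\<close>; the hull is
    compact, hence Borel, and on Borel sets the completion agrees with it.\<close>
  then have "triangle_area A B C = measure lborel (convex hull {A, B, C})"
    unfolding triangle_area_def
    by (intro measure_completion) (auto dest: compact_imp_closed)
  also have "\<dots> = sqrt (s * (s - a) * (s - a) * (s - b))"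
  proof -
    \<comment> \<open>The multiset does not say which side is the base \<open>b\<close>, so each of
      the three positions is considered.\<close>
    consider "dist B C = b" "dist A C = a" "dist A B = a"
      | "dist B C = a" "dist A C = b" "dist A B = a"
      | "dist B C = a" "dist A C = a" "dist A B = b"
      using assms by (auto simp: side_lengths_def add_eq_conv_ex dist_commute)
    then show ?thesis
      by cases (simp_all only: heron s_def mult_ac add_ac)
  qed
  also have "s * (s - a) * (s - a) * (s - b) = b\<^sup>2 * (4 * a\<^sup>2 - b\<^sup>2) / 4\<^sup>2"
    by (simp add: s_def field_simps power2_eq_square)
  finally show ?thesis
    by (simp add: real_sqrt_divide)
qed

lemma side_lengths_scaleR:
  "side_lengths (c *\<^sub>R A) (c *\<^sub>R B) (c *\<^sub>R C) = image_mset ((*) \<bar>c\<bar>) (side_lengths A B C)"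
  by (simp add: side_lengths_def dist_norm flip: scaleR_diff_right)

lemma is_triangle_scaleR:
  assumes "c \<noteq> 0"
  shows "is_triangle (c *\<^sub>R A) (c *\<^sub>R B) (c *\<^sub>R C) \<longleftrightarrow> is_triangle A B C"
proof -
  \<comment> \<open>One implication for arbitrary \<open>d\<close> suffices: the factors
    \<open>c\<close> and \<open>inverse c\<close> give the two directions.\<close>
  have *: "collinear {d *\<^sub>R X, d *\<^sub>R Y, d *\<^sub>R Z}" if "collinear {X, Y, Z}"
    for d :: real and X Y Z :: "real^2"
    using that unfolding collinear_def
    by (force simp flip: scaleR_diff_right simp: scaleR_left_commute)
  show ?thesis
    using *[of A B C c] *[of "c *\<^sub>R A" "c *\<^sub>R B" "c *\<^sub>R C" "inverse c"] assms
    by (auto simp: is_triangle_def)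
qed

text \<open>Write t for half the apex angle. Then \<open>k\<close> is sin t / (1 + cos t) = tan
  (t/2) with sin t = \<open>b / (2 * a)\<close> and cos t = \<open>2 * S / (a * b)\<close>, cleared
  of denominators. The last claim is twice the formula sin t =
  \<open>2 * k / (k\<^sup>2 + 1)\<close>; the proof checks it algebraically, without angles.\<close>

lemma isosceles_ratio:
  fixes a b S :: real
  assumes "a > 0" "b > 0" "S > 0" and "S = sqrt (b\<^sup>2 * (4 * a\<^sup>2 - b\<^sup>2)) / 4"
  defines "k \<equiv> b\<^sup>2 / (2 * a * b + 4 * S)"
  shows "k > 0" "k < 1" "4 * k / (k\<^sup>2 + 1) = b / a"
proof -
  define D where "D = 2 * a * b + 4 * S"
  have D: "D > 0"
    using assms(1-3) by (simp add: D_def add_pos_pos)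
  have k: "k = b\<^sup>2 / D"
    by (simp add: k_def D_def)
  \<comment> \<open>Positive area makes the radicand positive, which yields the strict triangle
    inequality \<open>b < 2 * a\<close> and from it \<open>k < 1\<close>.\<close>
  have "sqrt (b\<^sup>2 * (4 * a\<^sup>2 - b\<^sup>2)) > 0"
    using assms(3,4) by linarith
  then have pos: "b\<^sup>2 * (4 * a\<^sup>2 - b\<^sup>2) > 0"
    by (simp only: real_sqrt_gt_0_iff)
  have S2: "16 * S\<^sup>2 = b\<^sup>2 * (4 * a\<^sup>2 - b\<^sup>2)"
    unfolding assms(4) power_divide using pos by simp
  have "b\<^sup>2 < (2 * a)\<^sup>2"
    using pos by (simp add: zero_less_mult_iff power_mult_distrib)
  then have "b < 2 * a"
    using assms(1) by (auto intro: power2_less_imp_less[of b "2 * a"])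
  then have "b * b < D"
    unfolding D_def using mult_strict_right_mono[OF _ assms(2), of b "2 * a"] assms(3) by linarith
  then show "k < 1"
    using D by (simp add: k power2_eq_square)
  show "k > 0"
    using D assms(2) by (simp add: k)
  \<comment> \<open>Indeed
    \<open>D * (D - 4 * a * b) = (4 * S)\<^sup>2 - (2 * a * b)\<^sup>2\<close>, and by
    \<open>S2\<close> this equals \<open>- (b\<^sup>2 * b\<^sup>2)\<close>.\<close>
  have "b\<^sup>2 * b\<^sup>2 + D\<^sup>2 = 4 * a * b * D"
    using S2 by (simp add: D_def power2_eq_square algebra_simps)
  then have "k\<^sup>2 + 1 = 4 * a * b / D"
    using D by (simp add: k field_simps power2_eq_square)
  then show "4 * k / (k\<^sup>2 + 1) = b / a"
    using D assms(1,2) by (simp add: k power2_eq_square)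
qed

theorem theorem1p5:
  fixes A B C :: "real^2"
  assumes "heron_triangle A B C"
    and "isosceles A B C"
    and "has_two_square_sides A B C"
  shows "\<exists>k q :: real. k \<in> \<rat> \<and> k > 0 \<and> k \<noteq> 1 \<and> q \<in> \<rat> \<and> q > 0 \<and>
           (\<exists>P Q R :: real^2. is_triangle P Q R \<and>
              side_lengths P Q R = {# 1, 1, 4 * k / (k ^ 2 + 1) #} \<and>
              A = q *\<^sub>R P \<and> B = q *\<^sub>R Q \<and> C = q *\<^sub>R R)"
proof -
  obtain a M where M: "side_lengths A B C = {#a, a#} + M"
    using assms(2) unfolding isosceles_def by (auto simp: mset_subset_eq_exists_conv)
  moreover have "size (side_lengths A B C) = 3"
    by (simp add: side_lengths_def)
  ultimately have "size M = 1"
    by simp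
  then obtain b where sides: "side_lengths A B C = {#a, a, b#}"
    using M size_1_singleton_mset by fastforce
  define S where "S = triangle_area A B C"
  have ints: "a \<in> \<int>" "b \<in> \<int>" "S \<in> \<int>" and pos: "a > 0" "b > 0" "S > 0"
    using assms(1) sides by (auto simp: heron_triangle_def pos_integer_def S_def)
  \<comment> \<open>This form involves no square root, so \<open>k\<close> is rational as soon as
    \<open>a\<close>, \<open>b\<close> and \<open>S\<close> are.\<close>
  define k where "k = b\<^sup>2 / (2 * a * b + 4 * S)"
  have "S = sqrt (b\<^sup>2 * (4 * a\<^sup>2 - b\<^sup>2)) / 4"
    unfolding S_def by (rule triangle_area_isosceles[OF sides])
  note k = isosceles_ratio[OF pos this, folded k_def]
  have rats: "a \<in> \<rat>" "b \<in> \<rat>" "S \<in> \<rat>"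
    using ints Ints_subset_Rats by auto
  then have "k \<in> \<rat>"
    unfolding k_def by (intro Rats_divide Rats_add Rats_mult Rats_power Rats_number_of)
  \<comment> \<open>Dividing the vertices by the leg \<open>a\<close> gives \<open>P\<close>,
    \<open>Q\<close>, \<open>R\<close>, with sides 1, 1 and \<open>b / a\<close>.\<close>
  moreover have "is_triangle (inverse a *\<^sub>R A) (inverse a *\<^sub>R B) (inverse a *\<^sub>R C)"
    using assms(1) pos(1) by (subst is_triangle_scaleR) (auto simp: heron_triangle_def)
  moreover have "side_lengths (inverse a *\<^sub>R A) (inverse a *\<^sub>R B) (inverse a *\<^sub>R C) =
      {#1, 1, 4 * k / (k ^ 2 + 1)#}"
    unfolding side_lengths_scaleR sides k(3) using pos(1) by (simp add: divide_inverse_commute)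
  moreover have "X = a *\<^sub>R (inverse a *\<^sub>R X)" for X :: "real^2"
    using pos(1) by simp
  ultimately show ?thesis
    using k(1) less_imp_neq[OF k(2)] rats(1) pos(1)
    by (intro exI[of _ k] exI[of _ a] conjI exI[of _ "inverse a *\<^sub>R A"]
          exI[of _ "inverse a *\<^sub>R B"] exI[of _ "inverse a *\<^sub>R C"])
qed

end
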